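(* Let $n\ge1$ be an integer, let $a<b$ be real numbers, and let $P_0,\dots,P_{n-1}$ be continuous functions on $[a,b]$. For $r=0,1,\dots,n-1$ define on $[a,b]$ $$u_r(x)=\frac{(x-a)^r}{r!}+\int_a^x dz\,T(x,z)\Big(-\sum_{k=0}^{r}\frac{P_k(z)(z-a)^{r-k}}{(r-k)!}\Big),$$ where $T(x,y)$ is the function defined from $P_0,\dots,P_{n-1}$ in the context by a series of integrals. Then $u_0,\dots,u_{n-1}$ are $n$ linearly independent solutions on $[a,b]$ of $$\Big(\partial_x^n+\sum_{k=0}^{n-1}P_k(x)\,\partial_x^k\Big)u(x)=0,$$ and their Wronskian is $$W(u_0,u_1,\dots,u_{n-1})(x)=e^{-\int_a^x dz\,P_{n-1}(z)}.$$
   Context: Functions are complex-valued; integrals are oriented ($\int_y^x=-\int_x^y$). For $x,y\in[a,b]$ define $$h(x,y)=-\sum_{k=0}^{n-1}P_k(x)\,\frac{(x-y)^{n-k-1}}{(n-k-1)!},$$ $$R(x,y)=h(x,y)+\sum_{r=2}^{\infty}\int_y^x dz_1\int_y^{z_1}dz_2\cdots\int_y^{z_{r-2}}dz_{r-1}\,h(x,z_1)\,h(z_1,z_2)\cdots h(z_{r-1},y)$$ (for $r=2$ the term is $\int_y^x dz_1\,h(x,z_1)h(z_1,y)$), and $$T(x,y)=\frac{(x-y)^{n-1}}{(n-1)!}+\int_y^x dz\,\frac{(x-z)^{n-1}}{(n-1)!}\,R(z,y).$$ The Wronskian is $W(u_0,\dots,u_{n-1})(x)=\det\big(\partial_x^iu_j(x)\big)_{0\le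 i,j\le n-1}$. *)

theory Defs
  imports "HOL-Analysis.Analysis" "Jordan_Normal_Form.Determinant"
begin

text \<open>
  Integrals \<open>LBINT z=y..x. f z\<close> are oriented: exchanging the endpoints changes the sign.
  The coefficients are \<open>P 0, \<dots>, P (n - 1)\<close>; for \<open>x\<close> and \<open>y\<close> in \<open>{a..b}\<close> all the kernels below
  only involve values of the coefficients on \<open>{a..b}\<close>.
\<close>

definition kernel_h :: "nat \<Rightarrow> (nat \<Rightarrow> real \<Rightarrow> complex) \<Rightarrow> real \<Rightarrow> real \<Rightarrow> complex" where
  "kernel_h n P x y =
     - (\<Sum>k<n. P k x * complex_of_real ((x - y) ^ (n - k - 1) / fact (n - k - 1)))"

text \<open>
  \<open>nested_integral h y m w c\<close> is the \<open>m\<close>-fold integral, over \<open>\<zeta>\<^sub>1\<close> from \<open>y\<close> to \<open>w\<close>, \<open>\<zeta>\<^sub>2\<close> from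
  \<open>y\<close> to \<open>\<zeta>\<^sub>1\<close>, \<open>\<dots>\<close>, \<open>\<zeta>\<^sub>m\<close> from \<open>y\<close> to \<open>\<zeta>\<^sub>m\<^sub>-\<^sub>1\<close>, of
  \<open>c * h w \<zeta>\<^sub>1 * h \<zeta>\<^sub>1 \<zeta>\<^sub>2 * \<dots> * h \<zeta>\<^sub>m y\<close>. The argument \<open>c\<close> accumulates the factors of the
  integrand, so that the full product stands under the innermost integral.
\<close>

fun nested_integral ::
    "(real \<Rightarrow> real \<Rightarrow> complex) \<Rightarrow> real \<Rightarrow> nat \<Rightarrow> real \<Rightarrow> complex \<Rightarrow> complex" where
  "nested_integral h y 0 w c = c * h w y"
| "nested_integral h y (Suc m) w c = (LBINT z=y..w. nested_integral h y m z (c * h w z))"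

text \<open>The term with \<open>r\<close> factors of \<open>h\<close> has \<open>r - 1\<close> integrations; below \<open>r = m + 2\<close>.\<close>

definition kernel_R :: "nat \<Rightarrow> (nat \<Rightarrow> real \<Rightarrow> complex) \<Rightarrow> real \<Rightarrow> real \<Rightarrow> complex" where
  "kernel_R n P x y =
     kernel_h n P x y + (\<Sum>m. nested_integral (kernel_h n P) y (m + 1) x 1)"

definition kernel_T :: "nat \<Rightarrow> (nat \<Rightarrow> real \<Rightarrow> complex) \<Rightarrow> real \<Rightarrow> real \<Rightarrow> complex" where
  "kernel_T n P x y =
     complex_of_real ((x - y) ^ (n - 1) / fact (n - 1)) +
     (LBINT z=y..x. complex_of_real ((x - z) ^ (n - 1) / fact (n - 1)) * kernel_R n P z y)"

definition sol_u :: "nat \<Rightarrow> (nat \<Rightarrow> real \<Rightarrow> complex) \<Rightarrow> real \<Rightarrow> nat \<Rightarrow> real \<Rightarrow> complex" where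
  "sol_u n P a r x =
     complex_of_real ((x - a) ^ r / fact r) +
     (LBINT z=a..x. kernel_T n P x z *
        (- (\<Sum>k\<le>r. P k z * complex_of_real ((z - a) ^ (r - k) / fact (r - k)))))"

text \<open>
  Derivatives on \<open>{a..b}\<close> are taken within the interval, hence are one-sided at the endpoints.
  The values of the iterates outside \<open>{a..b}\<close> are meaningless and do not affect those inside.
\<close>

definition nth_deriv_on :: "real set \<Rightarrow> nat \<Rightarrow> (real \<Rightarrow> complex) \<Rightarrow> real \<Rightarrow> complex" where
  "nth_deriv_on S k = (\<lambda>f x. vector_derivative f (at x within S)) ^^ k"

definition times_differentiable_on :: "nat \<Rightarrow> (real \<Rightarrow> complex) \<Rightarrow> real set \<Rightarrow> bool" where
  "times_differentiable_on n f S \<longleftrightarrow> (\<forall>k<n. nth_deriv_on S k f differentiable_on S)"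

definition solves_linear_ode ::
    "nat \<Rightarrow> (nat \<Rightarrow> real \<Rightarrow> complex) \<Rightarrow> real set \<Rightarrow> (real \<Rightarrow> complex) \<Rightarrow> bool" where
  "solves_linear_ode n P S u \<longleftrightarrow>
     times_differentiable_on n u S \<and>
     (\<forall>x\<in>S. nth_deriv_on S n u x + (\<Sum>k<n. P k x * nth_deriv_on S k u x) = 0)"

definition linearly_independent_on ::
    "real set \<Rightarrow> nat \<Rightarrow> (nat \<Rightarrow> real \<Rightarrow> complex) \<Rightarrow> bool" where
  "linearly_independent_on S n u \<longleftrightarrow>
     (\<forall>c :: nat \<Rightarrow> complex. (\<forall>x\<in>S. (\<Sum>j<n. c j * u j x) = 0) \<longrightarrow> (\<forall>j<n. c j = 0))"

definition wronskian_on ::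
    "real set \<Rightarrow> nat \<Rightarrow> (nat \<Rightarrow> real \<Rightarrow> complex) \<Rightarrow> real \<Rightarrow> complex" where
  "wronskian_on S n u x =
     Determinant.det (Matrix.mat n n (\<lambda>(i, j). nth_deriv_on S i (u j) x))"

end

theory Submission
  imports Defs
begin

text \<open>
  For kernels \<open>k\<close>, \<open>l\<close> continuous on the triangle \<open>a \<le> y \<le> x \<le> b\<close>, write
  \<open>(k * l) x y = \<integral>\<^sub>y\<^sup>x k x z * l z y dz\<close>. This product again yields continuous kernels and, by
  Fubini's theorem on a triangle, is associative (\<open>volterra_assoc\<close>). All the constructions of
  the theorem are written with it. Put \<open>G\<^sub>m x y = (x - y)\<^sup>m / m!\<close>, so that
  \<open>G\<^sub>m\<^sub>+\<^sub>1 = G\<^sub>0 * G\<^sub>m\<close>. The nested integrals are powers of \<open>h\<close>, their sum \<open>R\<close> converges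
  uniformly because the \<open>m\<close>-th integral is at most \<open>M\<^sup>m\<^sup>+\<^sup>1 (x - y)\<^sup>m / m!\<close>, and \<open>R = h + h * R\<close>
  (\<open>resolvent_equation\<close>). Moreover \<open>T = G + G * R\<close> with \<open>G = G\<^sub>n\<^sub>-\<^sub>1\<close>.

  Let \<open>f\<close> be the parenthesised factor in the definition of \<open>u\<^sub>r\<close>, which is minus the value of the
  differential operator at \<open>(x - a)\<^sup>r / r!\<close>, and put \<open>\<phi> = f + R * f\<close>. Associativity gives
  \<open>T * f = G * \<phi>\<close> (\<open>volterra_resolvent_transfer\<close>) and \<open>\<phi> = f + h * \<phi>\<close>
  (\<open>volterra_second_kind\<close>). Hence \<open>u\<^sub>r = (x - a)\<^sup>r / r! + G * \<phi>\<close>. As differentiation in \<open>x\<close> turns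
  \<open>G\<^sub>m\<^sub>+\<^sub>1 * \<phi>\<close> into \<open>G\<^sub>m * \<phi>\<close> and \<open>G\<^sub>0 * \<phi>\<close> into \<open>\<phi>\<close>, the derivatives of \<open>u\<^sub>r\<close> up to order \<open>n\<close>
  are explicit. Since \<open>h = - \<Sum>\<^sub>k P\<^sub>k G\<^sub>n\<^sub>-\<^sub>1\<^sub>-\<^sub>k\<close>, the differential equation for \<open>u\<^sub>r\<close> says exactly
  \<open>\<phi> = f + h * \<phi>\<close> (\<open>sol_deriv_ode\<close>).

  At \<open>x = a\<close> the integrals vanish, so the Wronskian matrix of \<open>u\<^sub>0, \<dots>, u\<^sub>n\<^sub>-\<^sub>1\<close> is the identity there;
  this gives linear independence. The Wronskian \<open>W\<close> satisfies \<open>W' = - P\<^sub>n\<^sub>-\<^sub>1 W\<close>, because \<open>- P\<^sub>n\<^sub>-\<^sub>1\<close> is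
  the trace of the companion matrix (\<open>wronskian_chain\<close>), and \<open>W a = 1\<close>.
\<close>

section \<open>Volterra composition of continuous kernels\<close>

definition triangle :: "real \<Rightarrow> real \<Rightarrow> (real \<times> real) set" where
  "triangle a b = {(x, y). a \<le> y \<and> y \<le> x \<and> x \<le> b}"

text \<open>
  Only the values on the triangle matter: the coefficients are continuous on \<open>{a..b}\<close> alone, and
  the oriented integrals are needed only for a lower limit below the upper one.
\<close>

definition continuous_kernel :: "real \<Rightarrow> real \<Rightarrow> (real \<Rightarrow> real \<Rightarrow> complex) \<Rightarrow> bool" where
  "continuous_kernel a b k \<longleftrightarrow> continuous_on (triangle a b) (\<lambda>p. k (fst p) (snd p))"

definition volterra ::
    "(real \<Rightarrow> real \<Rightarrow> complex) \<Rightarrow> (real \<Rightarrow> real \<Rightarrow> complex) \<Rightarrow> real \<Rightarrow> real \<Rightarrow> complex" where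
  "volterra k l x y = integral {y..x} (\<lambda>z. k x z * l z y)"

lemma compact_triangle: "compact (triangle a b)"
proof -
  have "closed {p :: real \<times> real. a \<le> snd p \<and> snd p \<le> fst p \<and> fst p \<le> b}"
    by (intro closed_Collect_conj closed_Collect_le continuous_intros)
  moreover have "triangle a b = {p. a \<le> snd p \<and> snd p \<le> fst p \<and> fst p \<le> b}"
    by (auto simp: triangle_def)
  moreover have "triangle a b \<subseteq> cbox (a, a) (b, b)"
    by (auto simp: triangle_def cbox_Pair_eq)
  ultimately show ?thesis
    by (metis bounded_cbox bounded_subset compact_eq_bounded_closed)
qed

lemma continuous_kernel_compose:
  assumes "continuous_kernel a b k" "continuous_on S f" "continuous_on S g"
    and "\<And>s. s \<in> S \<Longrightarrow> a \<le> g s \<and> g s \<le> f s \<and> f s \<le> b"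
  shows "continuous_on S (\<lambda>s. k (f s) (g s))"
proof -
  have "continuous_on S (\<lambda>s. (\<lambda>p. k (fst p) (snd p)) (f s, g s))"
    using assms(1) unfolding continuous_kernel_def
    by (rule continuous_on_compose2) (use assms in \<open>auto simp: triangle_def intro!: continuous_intros\<close>)
  then show ?thesis by simp
qed

lemma continuous_on_volterra_integrand:
  assumes "continuous_kernel a b k" "continuous_kernel a b l" "a \<le> y" "x \<le> b"
  shows "continuous_on {y..x} (\<lambda>z. k x z * l z y)"
  by (intro continuous_intros continuous_kernel_compose[OF assms(1)]
      continuous_kernel_compose[OF assms(2)]) (use assms in auto)

text \<open>
  The substitution \<open>z = t * (x - y) + y\<close> moves both limits of integration into the integrand, so that
  continuity in \<open>(x, y)\<close> becomes continuity of an integral over a fixed interval in a parameter.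
\<close>

lemma volterra_rescale:
  assumes "continuous_kernel a b k" "continuous_kernel a b l" "a \<le> y" "y \<le> x" "x \<le> b"
  shows "volterra k l x y = of_real (x - y) *
    integral {0..1} (\<lambda>t. k x (t * (x - y) + y) * l (t * (x - y) + y) y)"
proof (cases "y = x")
  case True
  then show ?thesis by (simp add: volterra_def)
next
  case False
  then have pos: "x - y > 0" using assms by simp
  let ?g = "\<lambda>z. k x z * l z y"
  have "(?g has_integral volterra k l x y) (cbox y x)"
    unfolding volterra_def box_real
    by (intro integrable_integral integrable_continuous_real
        continuous_on_volterra_integrand[OF assms(1,2)] assms)
  from has_integral_affinity'[OF this pos, of y] pos
  have "((\<lambda>t. ?g ((x - y) * t + y)) has_integral (volterra k l x y /\<^sub>R (x - y))) {0..1}"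
    by simp
  then have "integral {0..1} (\<lambda>t. ?g ((x - y) * t + y)) = volterra k l x y /\<^sub>R (x - y)"
    by (rule integral_unique)
  then show ?thesis using pos
    by (simp add: mult.commute[of "x - y"] scaleR_conv_of_real field_simps)
qed

lemma continuous_kernel_volterra:
  assumes k: "continuous_kernel a b k" and l: "continuous_kernel a b l"
  shows "continuous_kernel a b (volterra k l)"
proof -
  let ?i = "\<lambda>p t. k (fst p) (t * (fst p - snd p) + snd p) * l (t * (fst p - snd p) + snd p) (snd p)"
  have le: "a \<le> snd p" "snd p \<le> fst p" "fst p \<le> b" if "p \<in> triangle a b" for p
    using that by (auto simp: triangle_def)
  have between: "snd p \<le> t * (fst p - snd p) + snd p" "t * (fst p - snd p) + snd p \<le> fst p"
    if "p \<in> triangle a b" "t \<in> cbox 0 1" for t p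
    using le[OF that(1)] that(2) mult_left_le_one_le[of "fst p - snd p" t] by simp_all
  have "continuous_on (triangle a b \<times> cbox 0 1) (\<lambda>(p, t). ?i p t)"
    unfolding case_prod_unfold
  proof (intro continuous_on_mult)
    show "continuous_on (triangle a b \<times> cbox 0 1)
        (\<lambda>s. k (fst (fst s)) (snd s * (fst (fst s) - snd (fst s)) + snd (fst s)))"
    proof (rule continuous_kernel_compose[OF k])
      fix s :: "(real \<times> real) \<times> real" assume "s \<in> triangle a b \<times> cbox 0 1"
      then have "fst s \<in> triangle a b" "snd s \<in> cbox 0 1" by auto
      from le[OF this(1)] between[OF this]
      show "a \<le> snd s * (fst (fst s) - snd (fst s)) + snd (fst s) \<and>
          snd s * (fst (fst s) - snd (fst s)) + snd (fst s) \<le> fst (fst s) \<and> fst (fst s) \<le> b"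
        by simp
    qed (intro continuous_intros)+
    show "continuous_on (triangle a b \<times> cbox 0 1)
        (\<lambda>s. l (snd s * (fst (fst s) - snd (fst s)) + snd (fst s)) (snd (fst s)))"
    proof (rule continuous_kernel_compose[OF l])
      fix s :: "(real \<times> real) \<times> real" assume "s \<in> triangle a b \<times> cbox 0 1"
      then have "fst s \<in> triangle a b" "snd s \<in> cbox 0 1" by auto
      from le[OF this(1)] between[OF this]
      show "a \<le> snd (fst s) \<and> snd (fst s) \<le> snd s * (fst (fst s) - snd (fst s)) + snd (fst s) \<and>
          snd s * (fst (fst s) - snd (fst s)) + snd (fst s) \<le> b"
        by simp
    qed (intro continuous_intros)+
  qed
  then have "continuous_on (triangle a b) (\<lambda>p. integral (cbox 0 1) (?i p))"
    by (rule integral_continuous_on_param)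
  then have "continuous_on (triangle a b) (\<lambda>p. of_real (fst p - snd p) * integral {0..1} (?i p))"
    by (intro continuous_intros) simp
  then show ?thesis
    unfolding continuous_kernel_def
    by (rule continuous_on_eq) (use le in \<open>simp add: volterra_rescale[OF k l]\<close>)
qed

lemma continuous_kernel_add:
  "continuous_kernel a b k \<Longrightarrow> continuous_kernel a b l \<Longrightarrow> continuous_kernel a b (\<lambda>x y. k x y + l x y)"
  unfolding continuous_kernel_def by (intro continuous_intros)

lemma continuous_kernel_mult:
  "continuous_kernel a b k \<Longrightarrow> continuous_kernel a b l \<Longrightarrow> continuous_kernel a b (\<lambda>x y. k x y * l x y)"
  unfolding continuous_kernel_def by (intro continuous_intros)

lemma continuous_kernel_left:
  "continuous_on {a..b} f \<Longrightarrow> continuous_kernel a b (\<lambda>x y. f x)"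
  unfolding continuous_kernel_def
  by (rule continuous_on_compose2[where f = fst]) (auto simp: triangle_def intro!: continuous_intros)

lemma continuous_on_kernel_section:
  "continuous_kernel a b k \<Longrightarrow> continuous_on {a..b} (\<lambda>x. k x a)"
  by (rule continuous_kernel_compose) (auto intro!: continuous_intros)

lemma volterra_add_left:
  assumes "continuous_kernel a b k" "continuous_kernel a b k'" "continuous_kernel a b l"
    "a \<le> y" "x \<le> b"
  shows "volterra (\<lambda>x y. k x y + k' x y) l x y = volterra k l x y + volterra k' l x y"
  unfolding volterra_def distrib_right
  by (intro Henstock_Kurzweil_Integration.integral_add integrable_continuous_real
      continuous_on_volterra_integrand[of a b] assms)

lemma volterra_add_right:
  assumes "continuous_kernel a b k" "continuous_kernel a b l" "continuous_kernel a b l'"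
    "a \<le> y" "x \<le> b"
  shows "volterra k (\<lambda>x y. l x y + l' x y) x y = volterra k l x y + volterra k l' x y"
  unfolding volterra_def distrib_left
  by (intro Henstock_Kurzweil_Integration.integral_add integrable_continuous_real
      continuous_on_volterra_integrand[of a b] assms)

lemma volterra_cong:
  assumes "\<And>z. y \<le> z \<Longrightarrow> z \<le> x \<Longrightarrow> k x z = k' x z" "\<And>z. y \<le> z \<Longrightarrow> z \<le> x \<Longrightarrow> l z y = l' z y"
  shows "volterra k l x y = volterra k' l' x y"
  unfolding volterra_def by (rule integral_cong) (use assms in auto)

lemma LBINT_eq_integral:
  fixes f :: "real \<Rightarrow> complex"
  assumes "y \<le> x" "continuous_on {y..x} f"
  shows "(LBINT z=y..x. f z) = integral {y..x} f"
  using assms by (intro interval_integral_eq_integral borel_integrable_atLeastAtMost')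

lemma LBINT_eq_volterra:
  assumes "continuous_kernel a b k" "continuous_kernel a b l" "a \<le> y" "y \<le> x" "x \<le> b"
  shows "(LBINT z=y..x. k x z * l z y) = volterra k l x y"
  unfolding volterra_def
  by (intro LBINT_eq_integral continuous_on_volterra_integrand[of a b] assms)

text \<open>
  Fubini's theorem for the product of the integrand with the indicator of the compact triangle,
  where it is continuous and hence integrable.
\<close>

lemma integral_triangle_swap:
  fixes F :: "real \<Rightarrow> real \<Rightarrow> complex"
  assumes F: "continuous_on (triangle y x) (\<lambda>p. F (fst p) (snd p))"
  shows "(LBINT z:{y..x}. LBINT w:{z..x}. F w z) = (LBINT w:{y..x}. LBINT z:{y..w}. F w z)"
proof -
  let ?f = "\<lambda>w z. indicator (triangle y x) (w, z) *\<^sub>R F w z"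
  have "integrable lborel (\<lambda>p. indicator (triangle y x) p *\<^sub>R F (fst p) (snd p))"
    by (intro borel_integrable_compact compact_triangle F)
  then have "integrable (lborel \<Otimes>\<^sub>M lborel) (\<lambda>(w, z). ?f w z)"
    by (simp add: lborel_prod case_prod_unfold)
  then have "(LINT z|lborel. LINT w|lborel. ?f w z) = (LINT w|lborel. LINT z|lborel. ?f w z)"
    by (rule lborel_pair.Fubini_integral)
  moreover have "(LINT w|lborel. ?f w z) = indicator {y..x} z *\<^sub>R (LBINT w:{z..x}. F w z)" for z
    unfolding set_lebesgue_integral_def Bochner_Integration.integral_scaleR_right[symmetric]
    by (rule Bochner_Integration.integral_cong) (auto simp: triangle_def indicator_def)
  moreover have "(LINT z|lborel. ?f w z) = indicator {y..x} w *\<^sub>R (LBINT z:{y..w}. F w z)" for w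
    unfolding set_lebesgue_integral_def Bochner_Integration.integral_scaleR_right[symmetric]
    by (rule Bochner_Integration.integral_cong) (auto simp: triangle_def indicator_def)
  ultimately show ?thesis
    by (simp add: set_lebesgue_integral_def)
qed

lemma LBINT_set_eq_integral:
  fixes f :: "real \<Rightarrow> complex"
  assumes "continuous_on {y..x} f"
  shows "(LBINT z:{y..x}. f z) = integral {y..x} f"
  by (intro set_borel_integral_eq_integral borel_integrable_atLeastAtMost' assms)

text \<open>
  Both sides integrate \<open>k x w * l w z * m z y\<close> over \<open>y \<le> z \<le> w \<le> x\<close>, in the two possible orders.
\<close>

lemma volterra_assoc:
  assumes k: "continuous_kernel a b k" and l: "continuous_kernel a b l"
    and m: "continuous_kernel a b m" and yx: "a \<le> y" "y \<le> x" "x \<le> b"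
  shows "volterra (volterra k l) m x y = volterra k (volterra l m) x y"
proof -
  let ?F = "\<lambda>w z. k x w * l w z * m z y"
  have F: "continuous_on (triangle y x) (\<lambda>p. ?F (fst p) (snd p))"
    by (intro continuous_on_mult continuous_kernel_compose[OF k] continuous_kernel_compose[OF l]
        continuous_kernel_compose[OF m] continuous_intros)
      (use yx in \<open>auto simp: triangle_def\<close>)
  have inner1: "(LBINT w:{z..x}. ?F w z) = volterra k l x z * m z y" if "z \<in> {y..x}" for z
  proof -
    have "(LBINT w:{z..x}. ?F w z) = (LBINT w:{z..x}. k x w * l w z) * m z y"
      by simp
    also have "(LBINT w:{z..x}. k x w * l w z) = volterra k l x z"
      unfolding volterra_def
      by (intro LBINT_set_eq_integral continuous_on_volterra_integrand[of a b])
        (use k l yx that in auto)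
    finally show ?thesis .
  qed
  have inner2: "(LBINT z:{y..w}. ?F w z) = k x w * volterra l m w y" if "w \<in> {y..x}" for w
  proof -
    have "(LBINT z:{y..w}. ?F w z) = k x w * (LBINT z:{y..w}. l w z * m z y)"
      unfolding mult.assoc by (rule set_integral_mult_right)
    also have "(LBINT z:{y..w}. l w z * m z y) = volterra l m w y"
      unfolding volterra_def
      by (intro LBINT_set_eq_integral continuous_on_volterra_integrand[of a b])
        (use l m yx that in auto)
    finally show ?thesis .
  qed
  have "volterra (volterra k l) m x y = (LBINT z:{y..x}. volterra k l x z * m z y)"
    unfolding volterra_def[of "volterra k l"]
    by (intro LBINT_set_eq_integral[symmetric] continuous_on_volterra_integrand[of a b]
        continuous_kernel_volterra k l m yx)
  also have "\<dots> = (LBINT z:{y..x}. LBINT w:{z..x}. ?F w z)"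
    by (intro set_lebesgue_integral_cong allI impI) (simp_all add: inner1 del: set_integral_mult_left set_integral_mult_right)
  also have "\<dots> = (LBINT w:{y..x}. LBINT z:{y..w}. ?F w z)"
    by (rule integral_triangle_swap[OF F])
  also have "\<dots> = (LBINT w:{y..x}. k x w * volterra l m w y)"
    by (intro set_lebesgue_integral_cong allI impI) (simp_all add: inner2 del: set_integral_mult_left set_integral_mult_right)
  also have "\<dots> = volterra k (volterra l m) x y"
    unfolding volterra_def[of k "volterra l m"]
    by (intro LBINT_set_eq_integral continuous_on_volterra_integrand[of a b]
        continuous_kernel_volterra k l m yx)
  finally show ?thesis .
qed

section \<open>Taylor kernels\<close>

definition taylor :: "nat \<Rightarrow> real \<Rightarrow> real \<Rightarrow> complex" where
  "taylor m x y = of_real ((x - y) ^ m / fact m)"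

lemma taylor_0 [simp]: "taylor 0 x y = 1"
  by (simp add: taylor_def)

lemma taylor_diag: "taylor m x x = (if m = 0 then 1 else 0)"
  by (simp add: taylor_def)

lemma continuous_kernel_taylor: "continuous_kernel a b (taylor m)"
  unfolding continuous_kernel_def taylor_def by (intro continuous_intros) auto

lemma power_over_fact_has_real_derivative:
  fixes y :: real
  shows "((\<lambda>x. (x - y) ^ Suc m / fact (Suc m)) has_real_derivative (x - y) ^ m / fact m) (at x within S)"
proof -
  have "((\<lambda>x. x - y) has_real_derivative 1) (at x within S)"
    by (auto intro!: derivative_eq_intros)
  then have "((\<lambda>x. (x - y) ^ Suc m / fact (Suc m)) has_real_derivative
      (1 + real m) * (1 * (x - y) ^ m) / fact (Suc m)) (at x within S)"
    by (intro DERIV_cdivide DERIV_power_Suc)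
  moreover have "(1 + real m) * (1 * (x - y) ^ m) / fact (Suc m) = (x - y) ^ m / fact m"
    using of_nat_0_less_iff[of "Suc m", where ?'a = real] by (simp del: of_nat_0_less_iff)
  ultimately show ?thesis by (rule DERIV_cong)
qed

lemma taylor_Suc_has_vector_derivative:
  "((\<lambda>x. taylor (Suc m) x y) has_vector_derivative taylor m x y) (at x within S)"
  unfolding taylor_def
  by (intro has_vector_derivative_of_real
      power_over_fact_has_real_derivative)

lemma volterra_taylor_0:
  assumes "y \<le> x"
  shows "volterra (taylor 0) (taylor m) x y = taylor (Suc m) x y"
proof -
  have "((\<lambda>z. taylor m z y) has_integral taylor (Suc m) x y - taylor (Suc m) y y) {y..x}"
    by (intro fundamental_theorem_of_calculus assms taylor_Suc_has_vector_derivative)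
  then show ?thesis
    by (simp add: volterra_def taylor_diag integral_unique)
qed

lemma volterra_taylor_0_has_vector_derivative:
  assumes "continuous_kernel a b l" "x \<in> {a..b}"
  shows "((\<lambda>x. volterra (taylor 0) l x a) has_vector_derivative l x a) (at x within {a..b})"
  unfolding volterra_def taylor_0 mult_1
  by (intro integral_has_vector_derivative continuous_on_kernel_section assms)

text \<open>
  The factorisation \<open>taylor (Suc m) = taylor 0 * taylor m\<close> and associativity exhibit the function as
  \<open>\<integral>\<^sub>a\<^sup>x\<close> of \<open>taylor m * l\<close>; this replaces differentiation under the integral sign.
\<close>

lemma volterra_taylor_Suc_has_vector_derivative:
  assumes l: "continuous_kernel a b l" and x: "x \<in> {a..b}"
  shows "((\<lambda>x. volterra (taylor (Suc m)) l x a) has_vector_derivative volterra (taylor m) l x a)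
    (at x within {a..b})"
proof -
  have "volterra (taylor (Suc m)) l t a = volterra (taylor 0) (volterra (taylor m) l) t a"
    if "t \<in> {a..b}" for t
  proof -
    have "volterra (taylor (Suc m)) l t a = volterra (volterra (taylor 0) (taylor m)) l t a"
      by (rule volterra_cong) (simp_all add: volterra_taylor_0)
    also have "\<dots> = volterra (taylor 0) (volterra (taylor m) l) t a"
      by (rule volterra_assoc[OF continuous_kernel_taylor continuous_kernel_taylor l])
        (use that in auto)
    finally show ?thesis .
  qed
  then show ?thesis
    using volterra_taylor_0_has_vector_derivative
      [OF continuous_kernel_volterra[OF continuous_kernel_taylor[of a b m] l] x]
    by (rule has_vector_derivative_transform[OF x])
qed

section \<open>The resolvent kernel\<close>

fun volterra_power :: "(real \<Rightarrow> real \<Rightarrow> complex) \<Rightarrow> nat \<Rightarrow> real \<Rightarrow> real \<Rightarrow> complex" where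
  "volterra_power h 0 = h"
| "volterra_power h (Suc m) = volterra h (volterra_power h m)"

lemma continuous_kernel_power:
  "continuous_kernel a b h \<Longrightarrow> continuous_kernel a b (volterra_power h m)"
  by (induction m) (auto intro: continuous_kernel_volterra)

text \<open>
  The accumulated factor \<open>c\<close> does not depend on the later integration variables, so it can be pulled
  out of every integral.
\<close>

lemma nested_integral_eq_volterra_power:
  assumes h: "continuous_kernel a b h" and "a \<le> y" "y \<le> x" "x \<le> b"
  shows "nested_integral h y m x c = c * volterra_power h m x y"
  using assms(3,4)
proof (induction m arbitrary: x c)
  case 0
  then show ?case by simp
next
  case (Suc m)
  have "nested_integral h y (Suc m) x c = (LBINT z=y..x. (c * h x z) * volterra_power h m z y)"
    unfolding nested_integral.simps
    by (rule interval_integral_cong) (use Suc in \<open>auto simp: einterval_iff\<close>)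
  also have "\<dots> = c * (LBINT z=y..x. h x z * volterra_power h m z y)"
    unfolding mult.assoc by simp
  also have "(LBINT z=y..x. h x z * volterra_power h m z y) = volterra h (volterra_power h m) x y"
    by (rule LBINT_eq_volterra[OF h continuous_kernel_power[OF h]]) (use assms Suc in auto)
  finally show ?case by simp
qed

text \<open>
  The factorial comes from integrating \<open>(z - y)\<^sup>m / m!\<close> once more at each step; it is what makes the
  series converge whatever the size of \<open>h\<close>.
\<close>

lemma volterra_power_bound:
  assumes h: "continuous_kernel a b h"
    and M: "\<And>x y. a \<le> y \<Longrightarrow> y \<le> x \<Longrightarrow> x \<le> b \<Longrightarrow> norm (h x y) \<le> M"
    and "a \<le> y" "y \<le> x" "x \<le> b"
  shows "norm (volterra_power h m x y) \<le> M ^ Suc m * ((x - y) ^ m / fact m)"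
  using assms(4,5)
proof (induction m arbitrary: x)
  case 0
  then show ?case using M assms by simp
next
  case (Suc m)
  have M0: "M \<ge> 0" using M[of a y] norm_ge_zero order_trans assms Suc by (meson order_refl)
  have I: "((\<lambda>z. M ^ Suc (Suc m) * ((z - y) ^ m / fact m)) has_integral
      M ^ Suc (Suc m) * ((x - y) ^ Suc m / fact (Suc m)) - M ^ Suc (Suc m) * ((y - y) ^ Suc m / fact (Suc m))) {y..x}"
  proof (intro fundamental_theorem_of_calculus Suc.prems)
    fix z assume "z \<in> {y..x}"
    show "((\<lambda>z. M ^ Suc (Suc m) * ((z - y) ^ Suc m / fact (Suc m))) has_vector_derivative
        M ^ Suc (Suc m) * ((z - y) ^ m / fact m)) (at z within {y..x})"
      using DERIV_cmult[OF power_over_fact_has_real_derivative]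
      by (simp only: has_real_derivative_iff_has_vector_derivative)
  qed
  have "norm (volterra_power h (Suc m) x y) \<le>
      integral {y..x} (\<lambda>z. M ^ Suc (Suc m) * ((z - y) ^ m / fact m))"
    unfolding volterra_power.simps volterra_def
  proof (rule integral_norm_bound_integral)
    show "(\<lambda>z. h x z * volterra_power h m z y) integrable_on {y..x}"
      by (intro integrable_continuous_real continuous_on_volterra_integrand[of a b]
          continuous_kernel_power h assms Suc.prems)
    show "(\<lambda>z. M ^ Suc (Suc m) * ((z - y) ^ m / fact m)) integrable_on {y..x}"
      using I by (rule has_integral_integrable)
    fix z assume z: "z \<in> {y..x}"
    then have "norm (h x z) \<le> M" "norm (volterra_power h m z y) \<le> M ^ Suc m * ((z - y) ^ m / fact m)"
      using M[of z x] Suc assms by auto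
    then have "norm (h x z) * norm (volterra_power h m z y) \<le> M * (M ^ Suc m * ((z - y) ^ m / fact m))"
      using M0 by (intro mult_mono) auto
    then show "norm (h x z * volterra_power h m z y) \<le> M ^ Suc (Suc m) * ((z - y) ^ m / fact m)"
      by (simp add: norm_mult mult.assoc)
  qed
  also have "\<dots> = M ^ Suc (Suc m) * ((x - y) ^ Suc m / fact (Suc m))"
    using integral_unique[OF I] by simp
  finally show ?case .
qed

text \<open>
  The Neumann series of \<open>h\<close>. With index \<open>m\<close> standing for \<open>m + 1\<close> factors, it has no unit term.
\<close>

definition resolvent :: "(real \<Rightarrow> real \<Rightarrow> complex) \<Rightarrow> real \<Rightarrow> real \<Rightarrow> complex" where
  "resolvent h x y = (\<Sum>m. volterra_power h m x y)"

lemma volterra_power_majorant: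
  assumes h: "continuous_kernel a b h"
  obtains B where "summable B"
    "\<And>m x y. a \<le> y \<Longrightarrow> y \<le> x \<Longrightarrow> x \<le> b \<Longrightarrow> norm (volterra_power h m x y) \<le> B m"
proof -
  have "bounded ((\<lambda>p. h (fst p) (snd p)) ` triangle a b)"
    using h unfolding continuous_kernel_def
    by (intro compact_imp_bounded compact_continuous_image compact_triangle)
  then obtain M where M0: "M > 0" and M': "\<And>p. p \<in> triangle a b \<Longrightarrow> norm (h (fst p) (snd p)) \<le> M"
    unfolding bounded_pos by auto
  have M: "norm (h x y) \<le> M" if "a \<le> y" "y \<le> x" "x \<le> b" for x y
    using M'[of "(x, y)"] that by (simp add: triangle_def)
  show ?thesis
  proof
    show "summable (\<lambda>m. M * (inverse (fact m) * (M * (b - a)) ^ m))"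
      by (intro summable_mult summable_exp)
    fix m x y assume xy: "a \<le> y" "y \<le> x" "x \<le> b"
    have "norm (volterra_power h m x y) \<le> M ^ Suc m * ((x - y) ^ m / fact m)"
      by (rule volterra_power_bound[OF h M xy])
    also have "\<dots> \<le> M ^ Suc m * ((b - a) ^ m / fact m)"
      using xy M0 by (intro mult_left_mono divide_right_mono power_mono) auto
    finally show "norm (volterra_power h m x y) \<le> M * (inverse (fact m) * (M * (b - a)) ^ m)"
      unfolding power_mult_distrib by (simp add: field_simps)
  qed
qed

lemma summable_volterra_power:
  assumes "continuous_kernel a b h" "a \<le> y" "y \<le> x" "x \<le> b"
  shows "summable (\<lambda>m. volterra_power h m x y)"
proof -
  obtain B where B: "summable B"
    "\<And>m x y. a \<le> y \<Longrightarrow> y \<le> x \<Longrightarrow> x \<le> b \<Longrightarrow> norm (volterra_power h m x y) \<le> B m"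
    by (rule volterra_power_majorant[OF assms(1)]) (rule that)
  show ?thesis
    by (rule summable_comparison_test'[OF B(1), of 0]) (rule B(2)[OF assms(2-4)])
qed

lemma resolvent_uniform_limit:
  assumes "continuous_kernel a b h"
  shows "uniform_limit (triangle a b) (\<lambda>N p. \<Sum>m<N. volterra_power h m (fst p) (snd p))
    (\<lambda>p. resolvent h (fst p) (snd p)) sequentially"
proof -
  obtain B where B: "summable B"
    "\<And>m x y. a \<le> y \<Longrightarrow> y \<le> x \<Longrightarrow> x \<le> b \<Longrightarrow> norm (volterra_power h m x y) \<le> B m"
    by (rule volterra_power_majorant[OF assms]) (rule that)
  show ?thesis
    unfolding resolvent_def
    by (rule Weierstrass_m_test[OF _ B(1)]) (auto simp: triangle_def intro: B(2))
qed

lemma continuous_kernel_resolvent: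
  assumes h: "continuous_kernel a b h"
  shows "continuous_kernel a b (resolvent h)"
  unfolding continuous_kernel_def
proof (rule uniform_limit_theorem[OF _ resolvent_uniform_limit[OF h]])
  show "\<forall>\<^sub>F N in sequentially. continuous_on (triangle a b)
      (\<lambda>p. \<Sum>m<N. volterra_power h m (fst p) (snd p))"
    using continuous_kernel_power[OF h] unfolding continuous_kernel_def
    by (intro always_eventually allI continuous_intros) auto
qed simp

text \<open>
  The convergence is uniform, so \<open>h * R\<close> is computed term by term and is the series of the powers of
  \<open>h\<close> without its first term.
\<close>

lemma resolvent_equation:
  assumes h: "continuous_kernel a b h" and xy: "a \<le> y" "y \<le> x" "x \<le> b"
  shows "resolvent h x y = h x y + volterra h (resolvent h) x y"
proof -
  note hp = continuous_kernel_power[OF h]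
  have "uniform_limit {y..x} (\<lambda>N z. \<Sum>m<N. volterra_power h m z y) (\<lambda>z. resolvent h z y) sequentially"
  proof -
    have "(\<lambda>z. (z, y)) \<in> {y..x} \<rightarrow> triangle a b"
      using xy by (auto simp: triangle_def)
    from uniform_limit_compose'[OF resolvent_uniform_limit[OF h] this] show ?thesis
      by simp
  qed
  moreover have "bounded (h x ` {y..x})"
    by (intro compact_imp_bounded compact_continuous_image continuous_kernel_compose[OF h]
        continuous_intros) (use xy in auto)
  moreover have "bounded ((\<lambda>z. resolvent h z y) ` {y..x})"
    by (intro compact_imp_bounded compact_continuous_image
        continuous_kernel_compose[OF continuous_kernel_resolvent[OF h]]
        continuous_intros) (use xy in auto)
  ultimately have lim: "uniform_limit {y..x} (\<lambda>N z. h x z * (\<Sum>m<N. volterra_power h m z y))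
      (\<lambda>z. h x z * resolvent h z y) sequentially"
    by (intro uniform_lim_mult uniform_limit_const)
  have cont: "continuous_on {y..x} (\<lambda>z. h x z * (\<Sum>m<N. volterra_power h m z y))" for N
    by (intro continuous_intros continuous_kernel_compose[OF h] continuous_kernel_compose[OF hp])
      (use xy in auto)
  obtain I J where IJ: "\<And>N. ((\<lambda>z. h x z * (\<Sum>m<N. volterra_power h m z y)) has_integral I N) {y..x}"
      "((\<lambda>z. h x z * resolvent h z y) has_integral J) {y..x}" "I \<longlonglongrightarrow> J"
    by (rule uniform_limit_integral[OF lim cont]) auto
  have "I N = (\<Sum>m<N. volterra_power h (Suc m) x y)" for N
  proof -
    have "I N = integral {y..x} (\<lambda>z. \<Sum>m<N. h x z * volterra_power h m z y)"
      using integral_unique[OF IJ(1)[of N]] by (simp add: sum_distrib_left)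
    also have "\<dots> = (\<Sum>m<N. integral {y..x} (\<lambda>z. h x z * volterra_power h m z y))"
      by (intro Henstock_Kurzweil_Integration.integral_sum finite_lessThan integrable_continuous_real
          continuous_on_volterra_integrand[of a b] h hp xy)
    finally show ?thesis by (simp add: volterra_def)
  qed
  then have "(\<lambda>m. volterra_power h (Suc m) x y) sums volterra h (resolvent h) x y"
    using IJ(3) integral_unique[OF IJ(2)] unfolding sums_def volterra_def[of h "resolvent h"]
    by presburger
  then have "(\<Sum>m. volterra_power h (Suc m) x y) = volterra h (resolvent h) x y"
    by (rule sums_unique[symmetric])
  then show ?thesis
    using suminf_split_head[OF summable_volterra_power[OF h xy]] by (simp add: resolvent_def)
qed

text \<open>
  The solution formula for the Volterra equation of the second kind: substitute
  \<open>R = h + h * R\<close> in \<open>R * f\<close> and factor \<open>h\<close> out on the left.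
\<close>

lemma volterra_second_kind:
  assumes h: "continuous_kernel a b h" and f: "continuous_kernel a b f"
    and xy: "a \<le> y" "y \<le> x" "x \<le> b"
  defines "\<phi> \<equiv> \<lambda>x y. f x y + volterra (resolvent h) f x y"
  shows "\<phi> x y = f x y + volterra h \<phi> x y"
proof -
  note R = continuous_kernel_resolvent[OF h]
  have "volterra (resolvent h) f x y = volterra (\<lambda>x y. h x y + volterra h (resolvent h) x y) f x y"
    by (rule volterra_cong) (use resolvent_equation[OF h] xy in auto)
  also have "\<dots> = volterra h f x y + volterra (volterra h (resolvent h)) f x y"
    by (intro volterra_add_left[of a b] continuous_kernel_volterra h R f xy)
  also have "volterra (volterra h (resolvent h)) f x y = volterra h (volterra (resolvent h) f) x y"
    by (rule volterra_assoc[OF h R f xy])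
  also have "volterra h f x y + volterra h (volterra (resolvent h) f) x y = volterra h \<phi> x y"
    unfolding \<phi>_def
    by (intro volterra_add_right[symmetric, of a b] continuous_kernel_volterra h R f xy)
  finally show ?thesis by (simp add: \<phi>_def)
qed

text \<open>
  The identity \<open>(g + g * R) * f = g * (f + R * f)\<close>. It moves the resolvent from the kernel to
  the source term, leaving the elementary kernel \<open>g\<close>, whose derivatives are known.
\<close>

lemma volterra_resolvent_transfer:
  assumes g: "continuous_kernel a b g" and R: "continuous_kernel a b R" and f: "continuous_kernel a b f"
    and xy: "a \<le> y" "y \<le> x" "x \<le> b"
  shows "volterra (\<lambda>x y. g x y + volterra g R x y) f x y = volterra g (\<lambda>x y. f x y + volterra R f x y) x y"
  using volterra_add_left[OF g continuous_kernel_volterra[OF g R] f xy(1,3)]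
    volterra_add_right[OF g f continuous_kernel_volterra[OF R f] xy(1,3)]
    volterra_assoc[OF g R f xy] by simp

section \<open>The kernels of the differential equation\<close>

lemma kernel_h_eq_taylor: "kernel_h n P x y = - (\<Sum>k<n. P k x * taylor (n - k - 1) x y)"
  by (simp add: kernel_h_def taylor_def)

lemma continuous_kernel_h:
  assumes "\<And>k. k < n \<Longrightarrow> continuous_on {a..b} (P k)"
  shows "continuous_kernel a b (kernel_h n P)"
proof -
  have "continuous_kernel a b (\<lambda>x y. P k x * taylor (n - k - 1) x y)" if "k < n" for k
    by (intro continuous_kernel_mult continuous_kernel_left continuous_kernel_taylor assms that)
  then show ?thesis
    unfolding continuous_kernel_def kernel_h_eq_taylor
    by (intro continuous_on_minus continuous_on_sum) simp
qed

lemma kernel_R_eq_resolvent: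
  assumes h: "continuous_kernel a b (kernel_h n P)" and xy: "a \<le> y" "y \<le> x" "x \<le> b"
  shows "kernel_R n P x y = resolvent (kernel_h n P) x y"
  using suminf_split_head[OF summable_volterra_power[OF h xy]]
  by (simp add: kernel_R_def resolvent_def nested_integral_eq_volterra_power[OF h xy]
      del: nested_integral.simps volterra_power.simps(2))

text \<open>
  The kernel \<open>T\<close> as a sum of Volterra compositions, \<open>G + G * R\<close>, for \<open>a \<le> y \<le> x \<le> b\<close>.
\<close>

definition green :: "nat \<Rightarrow> (nat \<Rightarrow> real \<Rightarrow> complex) \<Rightarrow> real \<Rightarrow> real \<Rightarrow> complex" where
  "green n P x y = taylor (n - 1) x y + volterra (taylor (n - 1)) (resolvent (kernel_h n P)) x y"

lemma continuous_kernel_green: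
  "continuous_kernel a b (kernel_h n P) \<Longrightarrow> continuous_kernel a b (green n P)"
  unfolding green_def
  by (intro continuous_kernel_add continuous_kernel_volterra continuous_kernel_taylor
      continuous_kernel_resolvent)

lemma kernel_T_eq_green:
  assumes h: "continuous_kernel a b (kernel_h n P)" and xy: "a \<le> y" "y \<le> x" "x \<le> b"
  shows "kernel_T n P x y = green n P x y"
proof -
  have "(LBINT z=y..x. taylor (n - 1) x z * kernel_R n P z y) =
      (LBINT z=y..x. taylor (n - 1) x z * resolvent (kernel_h n P) z y)"
    by (rule interval_integral_cong)
      (use xy in \<open>auto simp: einterval_iff kernel_R_eq_resolvent[OF h]\<close>)
  also have "\<dots> = volterra (taylor (n - 1)) (resolvent (kernel_h n P)) x y"
    by (intro LBINT_eq_volterra[of a b] continuous_kernel_taylor continuous_kernel_resolvent h xy)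
  finally show ?thesis by (simp add: kernel_T_def green_def taylor_def)
qed

section \<open>The solutions and their derivatives\<close>

text \<open>
  The right-hand side of the equation that the correction \<open>u\<^sub>r - (x - a)\<^sup>r / r!\<close> has to solve.
\<close>

definition forcing :: "(nat \<Rightarrow> real \<Rightarrow> complex) \<Rightarrow> real \<Rightarrow> nat \<Rightarrow> real \<Rightarrow> complex" where
  "forcing P a r x = - (\<Sum>k\<le>r. P k x * taylor (r - k) x a)"

text \<open>
  The \<open>n\<close>-th derivative of the solution is this function at \<open>y = a\<close>. The parameter \<open>y\<close> is kept so that
  it is a kernel and can be composed with others.
\<close>

definition density :: "nat \<Rightarrow> (nat \<Rightarrow> real \<Rightarrow> complex) \<Rightarrow> real \<Rightarrow> nat \<Rightarrow> real \<Rightarrow> real \<Rightarrow> complex" where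
  "density n P a r x y =
     forcing P a r x + volterra (resolvent (kernel_h n P)) (\<lambda>x y. forcing P a r x) x y"

text \<open>
  The \<open>k\<close>-th derivative of \<open>u\<^sub>r\<close>, for \<open>k \<le> n\<close>. At \<open>k = n\<close> there is no integration left.
\<close>

definition sol_deriv :: "nat \<Rightarrow> (nat \<Rightarrow> real \<Rightarrow> complex) \<Rightarrow> real \<Rightarrow> nat \<Rightarrow> nat \<Rightarrow> real \<Rightarrow> complex" where
  "sol_deriv n P a r k x =
     (if k \<le> r then taylor (r - k) x a else 0) +
     (if k < n then volterra (taylor (n - 1 - k)) (density n P a r) x a else density n P a r x a)"

context
  fixes n :: nat and a b :: real and P :: "nat \<Rightarrow> real \<Rightarrow> complex"
  assumes P: "\<And>k. k < n \<Longrightarrow> continuous_on {a..b} (P k)"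
begin

lemma continuous_kernel_forcing:
  assumes "r < n"
  shows "continuous_kernel a b (\<lambda>x y. forcing P a r x)"
proof (rule continuous_kernel_left)
  have "continuous_on {a..b} (\<lambda>x. taylor m x a)" for m
    by (rule continuous_on_kernel_section[OF continuous_kernel_taylor])
  then show "continuous_on {a..b} (forcing P a r)"
    unfolding forcing_def by (intro continuous_intros P) (use assms in auto)
qed

lemma continuous_kernel_density: "r < n \<Longrightarrow> continuous_kernel a b (density n P a r)"
  unfolding density_def
  by (intro continuous_kernel_add continuous_kernel_volterra continuous_kernel_forcing
      continuous_kernel_resolvent continuous_kernel_h P)

lemma sol_u_eq:
  assumes r: "r < n" and x: "x \<in> {a..b}"
  shows "sol_u n P a r x = sol_deriv n P a r 0 x"
proof -
  note h = continuous_kernel_h[OF P]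
  have "(LBINT z=a..x. kernel_T n P x z * forcing P a r z) =
      (LBINT z=a..x. green n P x z * forcing P a r z)"
    by (rule interval_integral_cong)
      (use x in \<open>auto simp: einterval_iff kernel_T_eq_green[OF h]\<close>)
  also have "\<dots> = volterra (green n P) (\<lambda>x y. forcing P a r x) x a"
    by (intro LBINT_eq_volterra[of a b "green n P" "\<lambda>x y. forcing P a r x"]
        continuous_kernel_green continuous_kernel_forcing h r) (use x in auto)
  also have "\<dots> = volterra (taylor (n - 1)) (density n P a r) x a"
    unfolding green_def density_def
    by (intro volterra_resolvent_transfer[of a b] continuous_kernel_taylor
        continuous_kernel_resolvent continuous_kernel_forcing h r) (use x in auto)
  finally show ?thesis
    using r by (simp add: sol_u_def sol_deriv_def forcing_def taylor_def)
qed

lemma sol_deriv_has_vector_derivative: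
  assumes r: "r < n" and k: "k < n" and x: "x \<in> {a..b}"
  shows "(sol_deriv n P a r k has_vector_derivative sol_deriv n P a r (Suc k) x) (at x within {a..b})"
proof -
  have "((\<lambda>x. if k \<le> r then taylor (r - k) x a else 0) has_vector_derivative
      (if Suc k \<le> r then taylor (r - Suc k) x a else 0)) (at x within {a..b})"
  proof (cases "Suc k \<le> r")
    case True
    then have "r - k = Suc (r - Suc k)" by simp
    with True show ?thesis by (simp add: taylor_Suc_has_vector_derivative)
  next
    case False
    then have "(\<lambda>x. if k \<le> r then taylor (r - k) x a else 0) = (\<lambda>x. if k = r then 1 else 0)"
      by auto
    with False show ?thesis by simp
  qed
  moreover have "((\<lambda>x. volterra (taylor (n - 1 - k)) (density n P a r) x a) has_vector_derivative
      (if Suc k < n then volterra (taylor (n - 1 - Suc k)) (density n P a r) x a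
       else density n P a r x a)) (at x within {a..b})"
  proof (cases "Suc k < n")
    case True
    then have "n - 1 - k = Suc (n - 1 - Suc k)" by simp
    with True show ?thesis
      using volterra_taylor_Suc_has_vector_derivative[OF continuous_kernel_density[OF r] x] by simp
  next
    case False
    with k have "n - 1 - k = 0" by simp
    with False show ?thesis
      using volterra_taylor_0_has_vector_derivative[OF continuous_kernel_density[OF r] x] by simp
  qed
  ultimately show ?thesis
    unfolding sol_deriv_def using k by (simp only: if_True has_vector_derivative_add)
qed

lemma volterra_kernel_h:
  assumes l: "continuous_kernel a b l" and x: "a \<le> y" "x \<le> b"
  shows "volterra (kernel_h n P) l x y = - (\<Sum>k<n. P k x * volterra (taylor (n - 1 - k)) l x y)"
proof -
  have "volterra (kernel_h n P) l x y =
      integral {y..x} (\<lambda>z. - (\<Sum>k<n. P k x * (taylor (n - 1 - k) x z * l z y)))"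
    unfolding volterra_def kernel_h_eq_taylor
    by (simp add: sum_distrib_right mult.assoc diff_commute)
  also have "\<dots> = - (\<Sum>k<n. integral {y..x} (\<lambda>z. P k x * (taylor (n - 1 - k) x z * l z y)))"
    unfolding Henstock_Kurzweil_Integration.integral_neg
    by (intro arg_cong[where f = uminus] Henstock_Kurzweil_Integration.integral_sum finite_lessThan
        integrable_continuous_real continuous_intros continuous_on_volterra_integrand[of a b]
        continuous_kernel_taylor l x)
  finally show ?thesis by (simp add: volterra_def)
qed

text \<open>
  The polynomial parts of the derivatives add up to \<open>- f\<close> and the integral parts to \<open>- h * \<phi>\<close>,
  so the equation is \<open>\<phi> = f + h * \<phi>\<close> for the density \<open>\<phi>\<close>.
\<close>

lemma sol_deriv_ode:
  assumes r: "r < n" and x: "x \<in> {a..b}"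
  shows "sol_deriv n P a r n x + (\<Sum>k<n. P k x * sol_deriv n P a r k x) = 0"
proof -
  let ?\<phi> = "density n P a r"
  have "(\<Sum>k<n. P k x * (if k \<le> r then taylor (r - k) x a else 0)) = - forcing P a r x"
  proof -
    have "(\<Sum>k<n. P k x * (if k \<le> r then taylor (r - k) x a else 0)) =
        (\<Sum>k\<le>r. P k x * (if k \<le> r then taylor (r - k) x a else 0))"
      by (rule sum.mono_neutral_right) (use r in auto)
    then show ?thesis by (simp add: forcing_def)
  qed
  moreover have "(\<Sum>k<n. P k x * volterra (taylor (n - 1 - k)) ?\<phi> x a) = - volterra (kernel_h n P) ?\<phi> x a"
    using volterra_kernel_h[OF continuous_kernel_density[OF r], of a x] x by simp
  moreover have "?\<phi> x a = forcing P a r x + volterra (kernel_h n P) ?\<phi> x a"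
    unfolding density_def
    by (intro volterra_second_kind[of a b] continuous_kernel_forcing continuous_kernel_h P r)
      (use x in auto)
  ultimately show ?thesis
    using r by (simp add: sol_deriv_def distrib_left sum.distrib)
qed

end

lemma sol_deriv_initial:
  assumes "k < n"
  shows "sol_deriv n P a r k a = (if k = r then 1 else 0)"
  using assms by (auto simp: sol_deriv_def taylor_diag volterra_def)

text \<open>
  Derivatives within a nondegenerate interval are unique, so any chain of successive derivatives
  starting at \<open>f\<close> computes the iterated derivatives, although these are only controlled on \<open>{a..b}\<close>.
\<close>

lemma nth_deriv_on_eq:
  assumes "a < b" and f: "\<And>x. x \<in> {a..b} \<Longrightarrow> f x = F 0 x"
    and F: "\<And>k x. k < n \<Longrightarrow> x \<in> {a..b} \<Longrightarrow> (F k has_vector_derivative F (Suc k) x) (at x within {a..b})"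
    and "k \<le> n" "x \<in> {a..b}"
  shows "nth_deriv_on {a..b} k f x = F k x"
  using assms(4,5)
proof (induction k arbitrary: x)
  case 0
  then show ?case by (simp add: nth_deriv_on_def f)
next
  case (Suc k)
  have "(nth_deriv_on {a..b} k f has_vector_derivative F (Suc k) x) (at x within {a..b})"
    by (rule has_vector_derivative_transform[OF _ _ F]) (use Suc in auto)
  then have "vector_derivative (nth_deriv_on {a..b} k f) (at x within {a..b}) = F (Suc k) x"
    by (rule vector_derivative_within_closed_interval[OF \<open>a < b\<close> Suc.prems(2)])
  then show ?case by (simp add: nth_deriv_on_def)
qed

lemma times_differentiable_onI:
  assumes "a < b" and f: "\<And>x. x \<in> {a..b} \<Longrightarrow> f x = F 0 x"
    and F: "\<And>k x. k < n \<Longrightarrow> x \<in> {a..b} \<Longrightarrow> (F k has_vector_derivative F (Suc k) x) (at x within {a..b})"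
  shows "times_differentiable_on n f {a..b}"
  unfolding times_differentiable_on_def differentiable_on_def
proof (intro allI impI ballI)
  fix k x assume "k < n" "x \<in> {a..b}"
  then have "(nth_deriv_on {a..b} k f has_vector_derivative F (Suc k) x) (at x within {a..b})"
    by (intro has_vector_derivative_transform[OF _ _ F] nth_deriv_on_eq[where n = n] assms) auto
  then show "nth_deriv_on {a..b} k f differentiable at x within {a..b}"
    by (rule differentiableI_vector)
qed

section \<open>Liouville's formula\<close>

text \<open>
  Laplace expansion along row \<open>k\<close>: the cofactors of that row do not see its entries.
\<close>

lemma det_replace_row:
  fixes A :: "nat \<Rightarrow> nat \<Rightarrow> 'a :: comm_ring_1"
  assumes "k < n"
  shows "Determinant.det (Matrix.mat n n (\<lambda>(i, j). if i = k then v j else A i j)) =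
    (\<Sum>j<n. v j * cofactor (Matrix.mat n n (\<lambda>(i, j). A i j)) k j)"
proof -
  let ?B = "Matrix.mat n n (\<lambda>(i, j). if i = k then v j else A i j)"
  have "cofactor ?B k j = cofactor (Matrix.mat n n (\<lambda>(i, j). A i j)) k j" if "j < n" for j
  proof -
    have "mat_delete ?B k j = mat_delete (Matrix.mat n n (\<lambda>(i, j). A i j)) k j"
      unfolding mat_delete_def by (rule eq_matI) (use that assms in auto)
    then show ?thesis by (simp add: cofactor_def)
  qed
  then show ?thesis
    using laplace_expansion_row[of ?B n k] assms by simp
qed

text \<open>
  By linearity in row \<open>k\<close>; copying another row \<open>l \<noteq> k\<close> there gives two equal rows, so only the
  term \<open>l = k\<close> survives.
\<close>

lemma det_replace_row_combination:
  fixes A :: "nat \<Rightarrow> nat \<Rightarrow> 'a :: comm_ring_1"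
  assumes k: "k < n"
  shows "Determinant.det (Matrix.mat n n (\<lambda>(i, j). if i = k then \<Sum>l<n. c l * A l j else A i j)) =
    c k * Determinant.det (Matrix.mat n n (\<lambda>(i, j). A i j))"
proof -
  let ?D = "\<lambda>l. Determinant.det (Matrix.mat n n (\<lambda>(i, j). if i = k then A l j else A i j))"
  have "Determinant.det (Matrix.mat n n (\<lambda>(i, j). if i = k then \<Sum>l<n. c l * A l j else A i j)) =
      (\<Sum>l<n. c l * ?D l)"
    unfolding det_replace_row[OF k] sum_distrib_right sum_distrib_left
    by (subst sum.swap) (simp add: mult.assoc)
  also have "\<dots> = (\<Sum>l<n. if l = k then c k * ?D k else 0)"
  proof (rule sum.cong[OF refl])
    fix l assume "l \<in> {..<n}"
    moreover have "?D l = 0" if "l < n" "l \<noteq> k"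
      by (rule det_identical_rows[of _ n k l]) (use that k in \<open>auto intro!: eq_vecI\<close>)
    ultimately show "c l * ?D l = (if l = k then c k * ?D k else 0)" by auto
  qed
  also have "\<dots> = c k * ?D k"
    using k by simp
  also have "(\<lambda>(i, j). if i = k then A k j else A i j) = (\<lambda>(i, j). A i j)"
    by auto
  finally show ?thesis .
qed

lemma has_vector_derivative_prod:
  fixes f :: "'i \<Rightarrow> real \<Rightarrow> 'a :: real_normed_field"
  assumes "\<And>i. i \<in> I \<Longrightarrow> (f i has_vector_derivative f' i) (at x within S)"
  shows "((\<lambda>x. \<Prod>i\<in>I. f i x) has_vector_derivative (\<Sum>i\<in>I. f' i * (\<Prod>j\<in>I - {i}. f j x))) (at x within S)"
  using has_derivative_prod[of I f "\<lambda>i y. y *\<^sub>R f' i" x S] assms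
  by (simp add: has_vector_derivative_def scaleR_sum_right)

text \<open>
  The product rule in each term of the Leibniz expansion; the terms in which the factor of row \<open>k\<close> is
  differentiated make up the \<open>k\<close>-th determinant.
\<close>

lemma det_has_vector_derivative:
  fixes A :: "nat \<Rightarrow> nat \<Rightarrow> real \<Rightarrow> complex"
  assumes A: "\<And>i j. i < n \<Longrightarrow> j < n \<Longrightarrow> (A i j has_vector_derivative A' i j) (at x within S)"
  shows "((\<lambda>x. Determinant.det (Matrix.mat n n (\<lambda>(i, j). A i j x))) has_vector_derivative
    (\<Sum>k<n. Determinant.det (Matrix.mat n n (\<lambda>(i, j). if i = k then A' i j else A i j x)))) (at x within S)"
proof -
  let ?S = "{p. p permutes {0..<n}}"
  have lt: "p i < n" if "p \<in> ?S" "i < n" for p i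
    using that permutes_in_image[of p "{0..<n}" i] by simp
  have det: "Determinant.det (Matrix.mat n n (\<lambda>(i, j). B i j)) =
      (\<Sum>p\<in>?S. signof p * (\<Prod>i=0..<n. B i (p i)))" for B :: "nat \<Rightarrow> nat \<Rightarrow> complex"
    by (subst det_def'[of _ n]) (auto intro!: sum.cong prod.cong simp: lt)
  have row: "(\<Prod>i=0..<n. if i = k then A' i (p i) else A i (p i) x) =
      A' k (p k) * (\<Prod>i\<in>{0..<n} - {k}. A i (p i) x)" if "k < n" for k p
    using that by (subst prod.remove[of _ k]) (auto intro!: prod.cong)
  have "((\<lambda>x. \<Sum>p\<in>?S. signof p * (\<Prod>i=0..<n. A i (p i) x)) has_vector_derivative
      (\<Sum>p\<in>?S. signof p * (\<Sum>k=0..<n. A' k (p k) * (\<Prod>i\<in>{0..<n} - {k}. A i (p i) x)))) (at x within S)"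
    by (intro has_vector_derivative_sum has_vector_derivative_mult_right has_vector_derivative_prod A)
      (auto simp: lt)
  also have "(\<Sum>p\<in>?S. signof p * (\<Sum>k=0..<n. A' k (p k) * (\<Prod>i\<in>{0..<n} - {k}. A i (p i) x))) =
      (\<Sum>k<n. \<Sum>p\<in>?S. signof p * (\<Prod>i=0..<n. if i = k then A' i (p i) else A i (p i) x))"
    unfolding sum_distrib_left atLeast0LessThan[symmetric]
    by (subst sum.swap) (auto intro!: sum.cong simp: row)
  finally show ?thesis unfolding det .
qed

text \<open>
  Liouville's formula for \<open>Y' = C Y\<close>: differentiating row \<open>k\<close> replaces it by the combination of rows
  with coefficients from row \<open>k\<close> of \<open>C\<close>, which multiplies the determinant by \<open>C k k\<close>.
\<close>

lemma det_linear_system_has_vector_derivative: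
  fixes Y :: "nat \<Rightarrow> nat \<Rightarrow> real \<Rightarrow> complex"
  assumes "\<And>i j. i < n \<Longrightarrow> j < n \<Longrightarrow>
    (Y i j has_vector_derivative (\<Sum>k<n. C i k * Y k j x)) (at x within S)"
  shows "((\<lambda>x. Determinant.det (Matrix.mat n n (\<lambda>(i, j). Y i j x))) has_vector_derivative
    (\<Sum>k<n. C k k) * Determinant.det (Matrix.mat n n (\<lambda>(i, j). Y i j x))) (at x within S)"
proof -
  have "(\<Sum>k<n. Determinant.det (Matrix.mat n n (\<lambda>(i, j). if i = k then \<Sum>l<n. C i l * Y l j x else Y i j x))) =
      (\<Sum>k<n. C k k * Determinant.det (Matrix.mat n n (\<lambda>(i, j). Y i j x)))"
  proof (rule sum.cong[OF refl])
    fix k assume "k \<in> {..<n}"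
    moreover have "(\<lambda>(i, j). if i = k then \<Sum>l<n. C i l * Y l j x else Y i j x) =
        (\<lambda>(i, j). if i = k then \<Sum>l<n. C k l * Y l j x else Y i j x)"
      by auto
    ultimately show "Determinant.det (Matrix.mat n n (\<lambda>(i, j). if i = k then \<Sum>l<n. C i l * Y l j x else Y i j x)) =
        C k k * Determinant.det (Matrix.mat n n (\<lambda>(i, j). Y i j x))"
      using det_replace_row_combination[of k n "C k" "\<lambda>i j. Y i j x"] by simp
  qed
  then show ?thesis
    using det_has_vector_derivative[of n Y "\<lambda>i j. \<Sum>k<n. C i k * Y k j x", OF assms]
    by (simp add: sum_distrib_right)
qed

lemma linear_scalar_ode_solution:
  fixes D p :: "real \<Rightarrow> complex"
  assumes p: "continuous_on {a..b} p"
    and D: "\<And>x. x \<in> {a..b} \<Longrightarrow> (D has_vector_derivative - p x * D x) (at x within {a..b})"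
    and x: "x \<in> {a..b}"
  shows "D x = D a * exp (- integral {a..x} p)"
proof -
  \<comment> \<open>With the integrating factor \<open>?E\<close>, the product \<open>D x * ?E x\<close> is constant.\<close>
  let ?E = "\<lambda>x. exp (integral {a..x} p)"
  have "((\<lambda>x. D x * ?E x) has_vector_derivative 0) (at t within {a..b})" if t: "t \<in> {a..b}" for t
  proof -
    have "((exp \<circ> (\<lambda>x. integral {a..x} p)) has_vector_derivative p t * ?E t) (at t within {a..b})"
      by (intro field_vector_diff_chain_within integral_has_vector_derivative p t
          DERIV_subset[OF DERIV_exp]) auto
    then have "((\<lambda>x. D x * ?E x) has_vector_derivative D t * (p t * ?E t) + (- p t * D t) * ?E t)
        (at t within {a..b})"
      unfolding o_def by (rule has_vector_derivative_mult[OF D[OF t]])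
    then show ?thesis by (simp add: algebra_simps)
  qed
  then obtain c where c: "\<And>t. t \<in> {a..b} \<Longrightarrow> D t * ?E t = c"
    using has_vector_derivative_zero_constant[of "{a..b}" "\<lambda>x. D x * ?E x"] by auto
  from c[OF x] c[of a] x have "D x * ?E x = D a" by simp
  then show ?thesis by (simp add: exp_minus field_simps)
qed

lemma companion_trace:
  fixes p :: "nat \<Rightarrow> 'a :: comm_ring_1"
  assumes "n \<ge> 1"
  shows "(\<Sum>k<n. if Suc k < n then (if k = Suc k then 1 else 0) else - p k) = - p (n - 1)"
proof -
  have "(\<Sum>k<n. if Suc k < n then (if k = Suc k then 1 else 0) else - p k) =
      (\<Sum>k<n. if k = n - 1 then - p (n - 1) else 0)"
    by (rule sum.cong) (use assms in auto)
  then show ?thesis using assms by simp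
qed

text \<open>
  Abel's identity. The rows of the Wronskian matrix satisfy the linear system of the companion matrix:
  each row but the last has the next one as derivative, and the equation expresses the derivative of the
  last row.
\<close>

lemma wronskian_chain:
  fixes F :: "nat \<Rightarrow> nat \<Rightarrow> real \<Rightarrow> complex"
  assumes n: "n \<ge> 1" and P: "continuous_on {a..b} (P (n - 1))"
    and F: "\<And>j k x. j < n \<Longrightarrow> k < n \<Longrightarrow> x \<in> {a..b} \<Longrightarrow>
      (F j k has_vector_derivative F j (Suc k) x) (at x within {a..b})"
    and ode: "\<And>j x. j < n \<Longrightarrow> x \<in> {a..b} \<Longrightarrow> F j n x + (\<Sum>k<n. P k x * F j k x) = 0"
    and x: "x \<in> {a..b}"
  shows "Determinant.det (Matrix.mat n n (\<lambda>(i, j). F j i x)) =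
    Determinant.det (Matrix.mat n n (\<lambda>(i, j). F j i a)) * exp (- integral {a..x} (P (n - 1)))"
proof (rule linear_scalar_ode_solution[OF P _ x, where D = "\<lambda>x. Determinant.det (Matrix.mat n n (\<lambda>(i, j). F j i x))"])
  fix t assume t: "t \<in> {a..b}"
  define C where "C i k = (if Suc i < n then (if k = Suc i then 1 else 0) else - P k t)" for i k
  have "(F j i has_vector_derivative (\<Sum>k<n. C i k * F j k t)) (at t within {a..b})"
    if i: "i < n" and j: "j < n" for i j
  proof -
    have "(\<Sum>k<n. C i k * F j k t) = F j (Suc i) t"
    proof (cases "Suc i < n")
      case True
      then have "(\<Sum>k<n. C i k * F j k t) = (\<Sum>k<n. if k = Suc i then F j k t else 0)"
        by (intro sum.cong) (auto simp: C_def)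
      with True show ?thesis by simp
    next
      case False
      with i have "Suc i = n" by simp
      with ode[OF j t] False show ?thesis
        by (simp add: C_def sum_negf add_eq_0_iff2)
    qed
    with F[OF j i t] show ?thesis by simp
  qed
  from det_linear_system_has_vector_derivative[of n "\<lambda>i j. F j i" C, OF this]
  show "((\<lambda>x. Determinant.det (Matrix.mat n n (\<lambda>(i, j). F j i x))) has_vector_derivative
      - P (n - 1) t * Determinant.det (Matrix.mat n n (\<lambda>(i, j). F j i t))) (at t within {a..b})"
    using companion_trace[OF n, of "\<lambda>k. P k t"] by (simp add: C_def)
qed

section \<open>The fundamental system\<close>

text \<open>
  A vanishing linear combination has vanishing derivatives; at \<open>a\<close> its \<open>k\<close>-th derivative is the \<open>k\<close>-th
  coefficient.
\<close>

lemma linearly_independent_onI: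
  fixes F :: "nat \<Rightarrow> nat \<Rightarrow> real \<Rightarrow> complex"
  assumes "a < b"
    and u: "\<And>j x. j < n \<Longrightarrow> x \<in> {a..b} \<Longrightarrow> u j x = F j 0 x"
    and F: "\<And>j k x. j < n \<Longrightarrow> k < n \<Longrightarrow> x \<in> {a..b} \<Longrightarrow>
      (F j k has_vector_derivative F j (Suc k) x) (at x within {a..b})"
    and init: "\<And>j k. j < n \<Longrightarrow> k < n \<Longrightarrow> F j k a = (if k = j then 1 else 0)"
  shows "linearly_independent_on {a..b} n u"
  unfolding linearly_independent_on_def
proof (intro allI impI)
  fix c :: "nat \<Rightarrow> complex" and i
  assume c: "\<forall>x\<in>{a..b}. (\<Sum>j<n. c j * u j x) = 0" and i: "i < n"
  have "\<forall>x\<in>{a..b}. (\<Sum>j<n. c j * F j k x) = 0" if "k < n" for k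
    using that
  proof (induction k)
    case 0
    then show ?case using c u by simp
  next
    case (Suc k)
    show ?case
    proof
      fix x assume x: "x \<in> {a..b}"
      have "((\<lambda>x. \<Sum>j<n. c j * F j k x) has_vector_derivative (\<Sum>j<n. c j * F j (Suc k) x))
          (at x within {a..b})"
        by (intro has_vector_derivative_sum has_vector_derivative_mult_right F) (use Suc x in auto)
      moreover have "((\<lambda>x. \<Sum>j<n. c j * F j k x) has_vector_derivative 0) (at x within {a..b})"
        by (rule has_vector_derivative_transform[OF x _ has_vector_derivative_const[of 0]])
          (use Suc in auto)
      ultimately show "(\<Sum>j<n. c j * F j (Suc k) x) = 0"
        using vector_derivative_within_closed_interval[OF \<open>a < b\<close> x] by metis
    qed
  qed
  with i \<open>a < b\<close> have "0 = (\<Sum>j<n. c j * F j i a)" by simp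
  also have "\<dots> = (\<Sum>j<n. if j = i then c i else 0)"
    by (rule sum.cong) (use i init in auto)
  finally show "c i = 0" using i by simp
qed

theorem mainTheorem4:
  fixes n :: nat and a b :: real and P :: "nat \<Rightarrow> real \<Rightarrow> complex"
  assumes "n \<ge> 1" and "a < b"
    and "\<And>k. k < n \<Longrightarrow> continuous_on {a..b} (P k)"
  shows "(\<forall>r<n. solves_linear_ode n P {a..b} (sol_u n P a r)) \<and>
         linearly_independent_on {a..b} n (sol_u n P a) \<and>
         (\<forall>x\<in>{a..b}. wronskian_on {a..b} n (sol_u n P a) x = exp (- (LBINT z=a..x. P (n - 1) z)))"
proof (intro conjI allI impI ballI)
  note u = sol_u_eq[where P = P and n = n, OF assms(3)]
  note F = sol_deriv_has_vector_derivative[where P = P and n = n, OF assms(3)]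
  note ode = sol_deriv_ode[where P = P and n = n, OF assms(3)]
  have deriv: "nth_deriv_on {a..b} k (sol_u n P a r) x = sol_deriv n P a r k x"
    if "r < n" "k \<le> n" "x \<in> {a..b}" for r k x
    by (rule nth_deriv_on_eq[OF \<open>a < b\<close> u F]) (use that in auto)
  show "solves_linear_ode n P {a..b} (sol_u n P a r)" if r: "r < n" for r
    unfolding solves_linear_ode_def
  proof (intro conjI ballI)
    show "times_differentiable_on n (sol_u n P a r) {a..b}"
      by (rule times_differentiable_onI[OF \<open>a < b\<close> u F]) (use r in auto)
    show "nth_deriv_on {a..b} n (sol_u n P a r) x +
        (\<Sum>k<n. P k x * nth_deriv_on {a..b} k (sol_u n P a r) x) = 0" if "x \<in> {a..b}" for x
      using ode[OF _ r that] deriv[OF r _ that] by simp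
  qed
  show "linearly_independent_on {a..b} n (sol_u n P a)"
    by (rule linearly_independent_onI[OF \<open>a < b\<close> u F sol_deriv_initial]) auto
  fix x assume x: "x \<in> {a..b}"
  have P': "continuous_on {a..b} (P (n - 1))"
    using assms by simp
  have "Matrix.mat n n (\<lambda>(i, j). sol_deriv n P a j i a) = 1\<^sub>m n"
    by (rule eq_matI) (auto simp: sol_deriv_initial)
  moreover have "wronskian_on {a..b} n (sol_u n P a) x =
      Determinant.det (Matrix.mat n n (\<lambda>(i, j). sol_deriv n P a j i x))"
    unfolding wronskian_on_def by (rule arg_cong[where f = Determinant.det], rule eq_matI)
      (use x in \<open>auto simp: deriv\<close>)
  moreover have "(LBINT z=a..x. P (n - 1) z) = integral {a..x} (P (n - 1))"
    by (rule LBINT_eq_integral) (use x continuous_on_subset[OF P', of "{a..x}"] in auto)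
  ultimately show "wronskian_on {a..b} n (sol_u n P a) x = exp (- (LBINT z=a..x. P (n - 1) z))"
    using wronskian_chain[where F = "sol_deriv n P a", OF \<open>n \<ge> 1\<close> P' F ode x] by simp
qed

end
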